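(* Let $G$ be a connected graph containing a swap set such that $\alpha(G)=3$. Then $DD_{\mathrm{m}}(G) \leq \alpha(G)$.
   Context: Graphs are finite, simple and undirected; $\alpha(G)$ is the independence number. Swap number: a dominating set $D$ of a graph $G$ is a swap set if there is a dominating set $D'$ of $G$ with $D\cap D'=\emptyset$, $|D|=|D'|$, such that $G$ contains a perfect matching between $D$ and $D'$ (a bijection $f:D\to D'$ with $x f(x)\in E(G)$ for all $x\in D$). $DD_{\mathrm{m}}(G)$ is the minimum cardinality of a swap set of $G$, and $DD_{\mathrm{m}}(G)=\infty$ if none exists. *)

theory Defs
  imports "Graph_Theory.Digraph_Component" "HOL-Library.Extended_Nat"
begin

text \<open>
  Finite simple undirected graphs are represented by \<^locale>\<open>pair_graph\<close>: an edge between
  \<open>u\<close> and \<open>v\<close> is the pair of arcs \<open>(u, v)\<close> and \<open>(v, u)\<close>.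
\<close>

definition independent_set :: "'a pair_pre_digraph \<Rightarrow> 'a set \<Rightarrow> bool" where
  "independent_set G S \<longleftrightarrow> S \<subseteq> pverts G \<and> (\<forall>u\<in>S. \<forall>v\<in>S. (u, v) \<notin> parcs G)"

definition independence_number :: "'a pair_pre_digraph \<Rightarrow> nat" where
  "independence_number G = Max (card ` {S. independent_set G S})"

definition dominating_set :: "'a pair_pre_digraph \<Rightarrow> 'a set \<Rightarrow> bool" where
  "dominating_set G D \<longleftrightarrow>
     D \<subseteq> pverts G \<and> (\<forall>v \<in> pverts G - D. \<exists>u\<in>D. (u, v) \<in> parcs G)"

definition swap_set :: "'a pair_pre_digraph \<Rightarrow> 'a set \<Rightarrow> bool" where
  "swap_set G D \<longleftrightarrow> dominating_set G D \<and>
     (\<exists>D'. dominating_set G D' \<and> D \<inter> D' = {} \<and> card D = card D' \<and>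
        (\<exists>f. bij_betw f D D' \<and> (\<forall>x\<in>D. (x, f x) \<in> parcs G)))"

text \<open>
  The infimum of the empty set in \<^typ>\<open>enat\<close> is \<open>\<infinity>\<close>, and every nonempty set of extended
  naturals attains its infimum, so this is the minimum with the convention for the case
  that there is no swap set.
\<close>

definition DD_m :: "'a pair_pre_digraph \<Rightarrow> enat" where
  "DD_m G = (INF D \<in> {D. swap_set G D}. enat (card D))"

end

theory Submission
  imports Defs
begin

text \<open>
  A swap set amounts to a matching with a 2-colouring of its edges such that every vertex outside
  the matching sees both colours. Of a swap set with more than three vertices only this is used:
  every vertex has a neighbour, any two vertices have distinct neighbours, and there are at least
  six vertices. Now compare the independent triples; each of them dominates. If two of them are disjoint, Hall's condition holds between them,
  since a violation gives four independent vertices. If two meet in a single vertex \<open>v\<close>, the rest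
  is matched in the same way, and the vertices that see only \<open>v\<close> in the second triple form a
  clique, from which the partner of \<open>v\<close> is taken. Otherwise either all triples contain a common
  pair \<open>u\<close>, \<open>v\<close> and there are at least two of them, or there is only one triple, and then every other
  vertex sees at least two of its members; in both cases suitable partners exist.
\<close>

section \<open>Neighbours and vertex count forced by a swap set; the independence number\<close>

context pair_graph
begin

abbreviation adj :: "'a \<Rightarrow> 'a \<Rightarrow> bool" where
  "adj u v \<equiv> (u, v) \<in> parcs G"

lemma adj_sym: "adj u v \<longleftrightarrow> adj v u"
  using sym_arcs by (auto simp: symmetric_def dest: symD)

lemma adj_irrefl [simp]: "\<not> adj u u"
  using no_loops by fastforce

lemma adj_verts: "adj u v \<Longrightarrow> u \<in> pverts G \<and> v \<in> pverts G"
  using in_arcsD1 in_arcsD2 by blast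

text \<open>Matched vertices take their partners, and distinct vertices have distinct partners. A
  vertex outside \<open>D\<close> and \<open>D'\<close> has a neighbour in each of them, so it can
  avoid whichever neighbour the other vertex uses.\<close>

lemma swap_set_neighbours:
  assumes "swap_set G D"
  shows "v \<in> pverts G \<Longrightarrow> \<exists>w. adj v w"
    and "\<lbrakk>u \<in> pverts G; v \<in> pverts G; u \<noteq> v\<rbrakk> \<Longrightarrow>
      \<exists>u' v'. u' \<noteq> v' \<and> adj u u' \<and> adj v v'"
proof -
  obtain D' f where D: "dominating_set G D" "dominating_set G D'" "D \<inter> D' = {}"
    and f: "bij_betw f D D'" "\<forall>x\<in>D. adj x (f x)"
    using assms unfolding swap_set_def by blast
  \<comment> \<open>The matching read from both sides, as an involution on \<open>D\<close> and
    \<open>D'\<close> together.\<close>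
  define g where "g x = (if x \<in> D then f x else inv_into D f x)" for x
  have g: "adj x (g x)" "g x \<in> D \<union> D'" "g (g x) = x" if "x \<in> D \<union> D'" for x
  proof -
    have "adj x (g x) \<and> g x \<in> D \<union> D' \<and> g (g x) = x"
    proof (cases "x \<in> D")
      case True
      then have "f x \<in> D'" "f x \<notin> D"
        using f(1) D(3) bij_betwE by blast+
      then show ?thesis
        using True f by (simp add: g_def bij_betw_inv_into_left)
    next
      case False
      then have "x \<in> D'" using that by blast
      then have "inv_into D f x \<in> D" "f (inv_into D f x) = x"
        using f(1) by (auto simp: bij_betw_def inv_into_into f_inv_into_f)
      then show ?thesis
        using False f(2) adj_sym by (metis UnI1 g_def)
    qed
    then show "adj x (g x)" "g x \<in> D \<union> D'" "g (g x) = x" by auto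
  qed
  have out: "\<exists>w w'. w \<noteq> w' \<and> adj x w \<and> adj x w'"
    if "x \<in> pverts G" "x \<notin> D \<union> D'" for x
    using that D adj_sym unfolding dominating_set_def by (metis Diff_iff Un_iff disjoint_iff)
  show nb: "\<exists>w. adj v w" if "v \<in> pverts G" for v
    using that g(1) out by blast
  show "\<exists>u' v'. u' \<noteq> v' \<and> adj u u' \<and> adj v v'"
    if "u \<in> pverts G" "v \<in> pverts G" "u \<noteq> v"
  proof (cases "u \<in> D \<union> D' \<and> v \<in> D \<union> D'")
    case True
    then have "g u \<noteq> g v"
      using g(3) that(3) by metis
    then show ?thesis
      using True g(1) by blast
  next
    case False
    then show ?thesis
      using out[of u] out[of v] nb that by metis
  qed
qed

lemma finite_independent_sets: "finite {S. independent_set G S}"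
  by (rule finite_subset[of _ "Pow (pverts G)"]) (auto simp: independent_set_def)

lemma card_le_independence_number:
  "independent_set G S \<Longrightarrow> card S \<le> independence_number G"
  unfolding independence_number_def using finite_independent_sets by (intro Max_ge) auto

lemma independence_number_attained:
  "\<exists>S. independent_set G S \<and> card S = independence_number G"
proof -
  have "independence_number G \<in> card ` {S. independent_set G S}"
    unfolding independence_number_def
  proof (rule Max_in)
    show "finite (card ` {S. independent_set G S})"
      using finite_independent_sets by (rule finite_imageI)
    have "independent_set G {}"
      by (simp add: independent_set_def)
    then show "card ` {S. independent_set G S} \<noteq> {}"
      by blast
  qed
  then show ?thesis by auto
qed

lemma swap_set_card_le:
  assumes "swap_set G D"
  shows "2 * card D \<le> card (pverts G)"
proof -
  obtain D' where D: "D \<subseteq> pverts G" "D' \<subseteq> pverts G" "D \<inter> D' = {}" "card D = card D'"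
    using assms unfolding swap_set_def dominating_set_def by blast
  then have "card (D \<union> D') = 2 * card D"
    using finite_subset[OF _ pair_finite_verts] by (simp add: card_Un_disjoint)
  then show ?thesis
    using D card_mono[of "pverts G" "D \<union> D'"] by auto
qed

end

section \<open>Graphs without four independent vertices: swap sets built from an independent
  triple\<close>

locale independence_three_graph = pair_graph G for G :: "'a pair_pre_digraph" +
  assumes no_independent_four:
    "\<lbrakk>a \<in> pverts G; b \<in> pverts G; c \<in> pverts G; d \<in> pverts G; distinct [a, b, c, d];
      \<not> adj a b; \<not> adj a c; \<not> adj a d;
      \<not> adj b c; \<not> adj b d; \<not> adj c d\<rbrakk> \<Longrightarrow> False"
    and distinct_neighbours:
    "\<lbrakk>u \<in> pverts G; v \<in> pverts G; u \<noteq> v\<rbrakk> \<Longrightarrow>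
      \<exists>u' v'. u' \<noteq> v' \<and> adj u u' \<and> adj v v'"
    and neighbour: "v \<in> pverts G \<Longrightarrow> \<exists>w. adj v w"
begin

definition independent_triple :: "'a \<Rightarrow> 'a \<Rightarrow> 'a \<Rightarrow> bool" where
  "independent_triple a b c \<longleftrightarrow> a \<in> pverts G \<and> b \<in> pverts G \<and> c \<in> pverts G \<and>
     a \<noteq> b \<and> a \<noteq> c \<and> b \<noteq> c \<and> \<not> adj a b \<and> \<not> adj a c \<and> \<not> adj b c"

lemma independent_triple_dominates:
  assumes "independent_triple a b c" "z \<in> pverts G" "z \<notin> {a, b, c}"
  shows "adj a z \<or> adj b z \<or> adj c z"
  using assms no_independent_four[of a b c z] by (auto simp: independent_triple_def)

text \<open>An independent triple contains no neighbour of its own members, so it is disjoint from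
  the partners, and its members are dominated by their own partners. Hence \<open>dom\<close> ranges
  only over the remaining vertices.\<close>

lemma swap_set_three:
  assumes "independent_triple a b c" "adj a a'" "adj b b'" "adj c c'" "distinct [a', b', c']"
    and dom: "\<And>z. \<lbrakk>z \<in> pverts G; z \<notin> {a, b, c, a', b', c'}\<rbrakk> \<Longrightarrow> adj a' z \<or> adj b' z \<or> adj c' z"
  shows "\<exists>D. swap_set G D \<and> card D = 3"
proof (intro exI conjI)
  note tri = assms(1)[unfolded independent_triple_def]
  define f where "f = (\<lambda>z. if z = a then a' else if z = b then b' else c')"
  have disj: "{a, b, c} \<inter> {a', b', c'} = {}"
    using tri assms(2-4) adj_sym adj_irrefl by blast
  have "dominating_set G {a, b, c}"
    using tri independent_triple_dominates[OF assms(1)] by (auto simp: dominating_set_def)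
  moreover have "dominating_set G {a', b', c'}"
    unfolding dominating_set_def
  proof (intro conjI ballI)
    show "{a', b', c'} \<subseteq> pverts G"
      using assms(2-4) adj_verts by blast
    fix z assume z: "z \<in> pverts G - {a', b', c'}"
    then show "\<exists>u\<in>{a', b', c'}. adj u z"
      using dom[of z] assms(2-4) adj_sym by (cases "z \<in> {a, b, c}") auto
  qed
  moreover have "card {a, b, c} = card {a', b', c'}"
    using tri assms(5) by auto
  moreover have "bij_betw f {a, b, c} {a', b', c'}"
    using tri assms(5) by (auto simp: bij_betw_def f_def inj_on_def)
  moreover have "\<forall>x \<in> {a, b, c}. adj x (f x)"
    using tri assms(2-4) by (auto simp: f_def)
  ultimately show "swap_set G {a, b, c}"
    unfolding swap_set_def using disj by blast
  show "card {a, b, c} = 3"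
    using tri by auto
qed

section \<open>Two independent triples meeting in at most one vertex\<close>

lemma swap_set_of_disjoint_triples:
  assumes x: "independent_triple x1 x2 x3" and y: "independent_triple y1 y2 y3"
    and disj: "{x1, x2, x3} \<inter> {y1, y2, y3} = {}"
  shows "\<exists>D. swap_set G D \<and> card D = 3"
proof -
  note tri = x[unfolded independent_triple_def] y[unfolded independent_triple_def]
  \<comment> \<open>Hall's condition between the triples: \<open>one\<close> covers single vertices,
    \<open>two\<close> covers pairs, \<open>one'\<close> the whole triple. Each violation would
    leave four independent vertices.\<close>
  have one: "adj x y1 \<or> adj x y2 \<or> adj x y3" if "x \<in> {x1, x2, x3}" for x
    using independent_triple_dominates[OF y, of x] that disj tri adj_sym by blast
  have one': "adj x1 y \<or> adj x2 y \<or> adj x3 y" if "y \<in> {y1, y2, y3}" for y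
    using independent_triple_dominates[OF x, of y] that disj tri by blast
  have two: "adj x y \<or> adj x y' \<or> adj x' y \<or> adj x' y'"
    if "x \<in> {x1, x2, x3}" "x' \<in> {x1, x2, x3}" "x \<noteq> x'"
      "y \<in> {y1, y2, y3}" "y' \<in> {y1, y2, y3}" "y \<noteq> y'" for x x' y y'
  proof -
    have "x \<in> pverts G" "x' \<in> pverts G" "y \<in> pverts G" "y' \<in> pverts G"
      using that tri by auto
    moreover have "distinct [x, x', y, y']"
      using that disj by auto
    moreover have "\<not> adj x x'" "\<not> adj y y'"
      using that tri adj_sym by blast+
    ultimately show ?thesis
      using no_independent_four[of x x' y y'] by blast
  qed
  \<comment> \<open>The disjuncts are the six bijections between the triples.\<close>
  have "(adj x1 y1 \<and> adj x2 y2 \<and> adj x3 y3) \<or> (adj x1 y1 \<and> adj x2 y3 \<and> adj x3 y2) \<or>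
        (adj x1 y2 \<and> adj x2 y1 \<and> adj x3 y3) \<or> (adj x1 y2 \<and> adj x2 y3 \<and> adj x3 y1) \<or>
        (adj x1 y3 \<and> adj x2 y1 \<and> adj x3 y2) \<or> (adj x1 y3 \<and> adj x2 y2 \<and> adj x3 y1)"
    using one[of x1] one[of x2] one[of x3] one'[of y1] one'[of y2] one'[of y3]
      two[of x1 x2 y1 y2] two[of x1 x2 y1 y3] two[of x1 x2 y2 y3]
      two[of x1 x3 y1 y2] two[of x1 x3 y1 y3] two[of x1 x3 y2 y3]
      two[of x2 x3 y1 y2] two[of x2 x3 y1 y3] two[of x2 x3 y2 y3] tri
    by simp argo
  then obtain z1 z2 z3 where z: "adj x1 z1" "adj x2 z2" "adj x3 z3" "{z1, z2, z3} = {y1, y2, y3}"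
    by (elim disjE) (force+)
  have "distinct [z1, z2, z3]"
  proof (rule card_distinct)
    have "card (set [z1, z2, z3]) = card {y1, y2, y3}"
      using z(4) by simp
    then show "card (set [z1, z2, z3]) = length [z1, z2, z3]"
      using tri by simp
  qed
  then show ?thesis
    using swap_set_three[OF x z(1-3)] independent_triple_dominates[OF y] z(4)
    by (smt (verit) insert_iff empty_iff)
qed

lemma swap_set_of_triples_meeting_once:
  assumes x: "independent_triple v x1 x2" and y: "independent_triple v y1 y2"
    and disj: "{x1, x2} \<inter> {y1, y2} = {}"
  shows "\<exists>D. swap_set G D \<and> card D = 3"
proof -
  note tri = x[unfolded independent_triple_def] y[unfolded independent_triple_def]
  \<comment> \<open>\<open>v\<close> is adjacent to none of the other four vertices, so domination
    comes from the opposite pair; this is Hall's condition for the two pairs.\<close>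
  have one: "adj x1 y1 \<or> adj x1 y2" "adj x2 y1 \<or> adj x2 y2"
    using independent_triple_dominates[OF y, of x1] independent_triple_dominates[OF y, of x2]
      disj tri adj_sym by blast+
  have one': "adj x1 y1 \<or> adj x2 y1" "adj x1 y2 \<or> adj x2 y2"
    using independent_triple_dominates[OF x, of y1] independent_triple_dominates[OF x, of y2]
      disj tri by blast+
  obtain z1 z2 where z: "adj x1 z1" "adj x2 z2" "{z1, z2} = {y1, y2}"
    using one one' by blast
  have ytri: "independent_triple v z1 z2"
    using y z(3) adj_sym by (auto simp: independent_triple_def doubleton_eq_iff)
  note ztri = ytri[unfolded independent_triple_def]
  define F where "F = {w. adj v w \<and> \<not> adj z1 w \<and> \<not> adj z2 w}"
  \<comment> \<open>Two non-adjacent members would be independent together with \<open>z1\<close>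
    and \<open>z2\<close>, so any \<open>v'\<close> in \<open>F\<close> dominates the rest of
    \<open>F\<close>.\<close>
  have clique: "adj w w'" if "w \<in> F" "w' \<in> F" "w \<noteq> w'" for w w'
    using that no_independent_four[of z1 z2 w w'] ztri adj_verts by (auto simp: F_def)
  obtain v' where v': "adj v v'" "F = {} \<or> v' \<in> F"
    using neighbour tri by (cases "F = {}") (auto simp: F_def)
  show ?thesis
  proof (rule swap_set_three[OF x v'(1) z(1,2)])
    show "distinct [v', z1, z2]"
      using ztri v'(1) by auto
    fix w assume w: "w \<in> pverts G" "w \<notin> {v, x1, x2, v', z1, z2}"
    then have "adj z1 w \<or> adj z2 w \<or> w \<in> F"
      using independent_triple_dominates[OF ytri, of w] by (auto simp: F_def)
    then show "adj v' w \<or> adj z1 w \<or> adj z2 w"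
      using clique[of v' w] v'(2) w(2) by blast
  qed
qed

section \<open>All triples through a common pair, or only one triple\<close>

lemma swap_set_of_common_pair:
  assumes t: "independent_triple u v t" and s: "independent_triple u v s" and "t \<noteq> s"
    and all: "\<And>x y z. independent_triple x y z \<Longrightarrow> u \<in> {x, y, z} \<and> v \<in> {x, y, z}"
  shows "\<exists>D. swap_set G D \<and> card D = 3"
proof -
  note tri = t[unfolded independent_triple_def] s[unfolded independent_triple_def]
  have ts: "adj t s"
    using tri \<open>t \<noteq> s\<close> no_independent_four[of u v t s] by auto
  \<comment> \<open>With \<open>s\<close> as the partner of \<open>t\<close>, \<open>F\<close> is
    what the partners of \<open>u\<close> and \<open>v\<close> must still dominate.\<close>
  define F where "F = {w \<in> pverts G. w \<notin> {u, v, s} \<and> \<not> adj s w}"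
  \<comment> \<open>A missing edge inside \<open>F\<close>, or from \<open>F\<close> to
    \<open>u\<close> or \<open>v\<close>, would give an independent triple through \<open>s\<close>
    that omits \<open>u\<close> or \<open>v\<close>.\<close>
  have clique: "adj w w'" if "w \<in> F" "w' \<in> F" "w \<noteq> w'" for w w'
    using that all[of s w w'] tri by (auto simp: F_def independent_triple_def)
  have F_adj: "adj u w" "adj v w" if "w \<in> F" for w
    using that all[of s w v] all[of s w u] tri adj_sym
    by (auto simp: F_def independent_triple_def)
  obtain p q where pq: "p \<noteq> q" "adj u p" "adj v q"
    using distinct_neighbours[of u v] tri by blast
  obtain u' v' where uv': "u' \<noteq> v'" "adj u u'" "adj v v'" "F = {} \<or> u' \<in> F \<or> v' \<in> F"
  proof (cases "F = {}")
    case True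
    then show ?thesis using that pq by blast
  next
    case False
    \<comment> \<open>\<open>w\<close> cannot equal both \<open>p\<close> and \<open>q\<close>: it
      replaces \<open>p\<close> at \<open>u\<close> or \<open>q\<close> at \<open>v\<close>, and the
      two neighbours stay distinct.\<close>
    then obtain w where "w \<in> F" by blast
    then show ?thesis
      using that[of w q] that[of p w] pq F_adj[of w] by blast
  qed
  show ?thesis
  proof (rule swap_set_three[OF t uv'(2,3) ts])
    show "distinct [u', v', s]"
      using uv' tri by auto
    fix w assume w: "w \<in> pverts G" "w \<notin> {u, v, t, u', v', s}"
    then have "adj s w \<or> w \<in> F"
      by (auto simp: F_def)
    then show "adj u' w \<or> adj v' w \<or> adj s w"
      using clique[of u' w] clique[of v' w] uv'(4) w(2) by blast
  qed
qed

lemma swap_set_of_unique_triple: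
  assumes abc: "independent_triple a b c"
    and all: "\<And>x y z. independent_triple x y z \<Longrightarrow> {x, y, z} = {a, b, c}"
    and card: "6 \<le> card (pverts G)"
  shows "\<exists>D. swap_set G D \<and> card D = 3"
proof -
  note tri = abc[unfolded independent_triple_def]
  define W where "W = pverts G - {a, b, c}"
  \<comment> \<open>A vertex missing two members would form a second triple with them.\<close>
  have two: "adj a w \<or> adj b w" "adj a w \<or> adj c w" "adj b w \<or> adj c w" if "w \<in> W" for w
    using that all[of a b w] all[of a c w] all[of b c w] tri
    by (auto simp: W_def independent_triple_def)
  have card_W: "3 \<le> card W"
    using card tri by (simp add: W_def card_Diff_subset)
  \<comment> \<open>The pair is chosen to dominate \<open>W\<close>. If \<open>W\<close> is a
    clique, any pair works; otherwise a vertex of \<open>W\<close> missing both of a non-adjacent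
    pair would complete a second triple.\<close>
  obtain w1 w2 where w12: "w1 \<in> W" "w2 \<in> W" "w1 \<noteq> w2"
    "\<not> adj w1 w2 \<or> (\<forall>x\<in>W. \<forall>y\<in>W. x \<noteq> y \<longrightarrow> adj x y)"
  proof (cases "\<forall>x\<in>W. \<forall>y\<in>W. x \<noteq> y \<longrightarrow> adj x y")
    case True
    obtain T where "T \<subseteq> W" "card T = 2"
      using obtain_subset_with_card_n[of 2 W] card_W by auto
    then show ?thesis
      using that True by (auto simp: card_2_iff)
  next
    case False
    then show ?thesis using that by blast
  qed
  have dom: "adj w1 z \<or> adj w2 z" if "z \<in> W" "z \<notin> {w1, w2}" for z
    using w12 that all[of w1 w2 z] by (auto simp: W_def independent_triple_def)
  have "\<not> W \<subseteq> {w1, w2}"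
    using card_W card_mono[of "{w1, w2}" W] w12(3) by auto
  then obtain w3 where w3: "w3 \<in> W" "w3 \<noteq> w1" "w3 \<noteq> w2"
    by blast
  obtain x y z where nb: "adj a x" "adj b y" "adj c z"
    using neighbour tri by blast
  \<comment> \<open>Three vertices of \<open>W\<close> fail to be matched to \<open>a\<close>, \<open>b\<close>, \<open>c\<close> only if they all miss the same
    member, whose neighbour then replaces \<open>w3\<close>.\<close>
  have "\<exists>a' b' c'. adj a a' \<and> adj b b' \<and> adj c c' \<and> distinct [a', b', c'] \<and>
      {w1, w2} \<subseteq> {a', b', c'}"
  proof -
    consider "\<not> adj a w1" "\<not> adj a w2" "\<not> adj a w3" | "\<not> adj b w1" "\<not> adj b w2" "\<not> adj b w3"
      | "\<not> adj c w1" "\<not> adj c w2" "\<not> adj c w3"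
      | "adj a w1 \<or> adj a w2 \<or> adj a w3" "adj b w1 \<or> adj b w2 \<or> adj b w3"
        "adj c w1 \<or> adj c w2 \<or> adj c w3"
      by blast
    then show ?thesis
    proof cases
      case 1
      then show ?thesis
        using two[OF w12(1)] two[OF w12(2)] nb w12(3)
        by (intro exI[of _ x] exI[of _ w1] exI[of _ w2]) auto
    next
      case 2
      then show ?thesis
        using two[OF w12(1)] two[OF w12(2)] nb w12(3)
        by (intro exI[of _ w1] exI[of _ y] exI[of _ w2]) auto
    next
      case 3
      then show ?thesis
        using two[OF w12(1)] two[OF w12(2)] nb w12(3)
        by (intro exI[of _ w1] exI[of _ w2] exI[of _ z]) auto
    next
      case 4
      \<comment> \<open>Hall's condition again: each \<open>w\<close> sees two members, and each
        member is seen by some \<open>w\<close>.\<close>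
      then have "(adj a w1 \<and> adj b w2 \<and> adj c w3) \<or> (adj a w1 \<and> adj b w3 \<and> adj c w2) \<or>
        (adj a w2 \<and> adj b w1 \<and> adj c w3) \<or> (adj a w2 \<and> adj b w3 \<and> adj c w1) \<or>
        (adj a w3 \<and> adj b w1 \<and> adj c w2) \<or> (adj a w3 \<and> adj b w2 \<and> adj c w1)"
        using two[OF w12(1)] two[OF w12(2)] two[OF w3(1)] by argo
      moreover have "distinct [w1, w2, w3]"
        using w12(3) w3 by auto
      ultimately show ?thesis
        by (elim disjE) force+
    qed
  qed
  then obtain a' b' c' where m: "adj a a'" "adj b b'" "adj c c'" "distinct [a', b', c']"
      "{w1, w2} \<subseteq> {a', b', c'}"
    by blast
  show ?thesis
    using swap_set_three[OF abc m(1-4)] dom m(5) unfolding W_def by blast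
qed

section \<open>Combining the cases\<close>

lemma independent_triple_rotate:
  assumes "independent_triple a b c" "x \<in> {a, b, c}"
  obtains p q where "independent_triple x p q" "{x, p, q} = {a, b, c}"
proof -
  have "independent_triple a b c" "independent_triple b a c" "independent_triple c a b"
    using assms(1) adj_sym by (auto simp: independent_triple_def)
  then show thesis
    using assms(2) that by blast
qed

text \<open>Without a swap set of size three, any two triples share a pair (\<open>share\<close>),
  and there is more than one triple. Two distinct ones then determine a pair \<open>u\<close>,
  \<open>v\<close> that lies in every triple.\<close>

lemma swap_set_of_independent_triple:
  assumes abc: "independent_triple a b c" and card: "6 \<le> card (pverts G)"
  shows "\<exists>D. swap_set G D \<and> card D = 3"
proof (rule ccontr)
  assume no: "\<not> ?thesis"
  have swap: "independent_triple x z y" if "independent_triple x y z" for x y z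
    using that adj_sym by (auto simp: independent_triple_def)
  have share: "\<exists>u v t s. independent_triple u v t \<and> independent_triple u v s \<and>
      {u, v, t} = {x, y, z} \<and> {u, v, s} = {x', y', z'}"
    if x: "independent_triple x y z" and x': "independent_triple x' y' z'" for x y z x' y' z'
  proof -
    obtain u where u: "u \<in> {x, y, z}" "u \<in> {x', y', z'}"
      using swap_set_of_disjoint_triples[OF x x'] no by blast
    obtain p q where pq: "independent_triple u p q" "{u, p, q} = {x, y, z}"
      using independent_triple_rotate[OF x u(1)] .
    obtain r s where rs: "independent_triple u r s" "{u, r, s} = {x', y', z'}"
      using independent_triple_rotate[OF x' u(2)] .
    obtain v where v: "v \<in> {p, q}" "v \<in> {r, s}"
      using swap_set_of_triples_meeting_once[OF pq(1) rs(1)] no by blast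
    have "\<exists>t. independent_triple u v t \<and> {u, v, t} = {x, y, z}"
      using v(1) pq swap by blast
    moreover have "\<exists>t. independent_triple u v t \<and> {u, v, t} = {x', y', z'}"
      using v(2) rs swap by blast
    ultimately show ?thesis by blast
  qed
  obtain x y z where "independent_triple x y z" "{x, y, z} \<noteq> {a, b, c}"
    using swap_set_of_unique_triple[OF abc _ card] no by blast
  then obtain u v t s where uvt: "independent_triple u v t" "independent_triple u v s" "t \<noteq> s"
    using share[OF abc] by metis
  note tri = uvt(1,2)[unfolded independent_triple_def]
  have ts: "adj t s"
    using tri uvt(3) no_independent_four[of u v t s] by auto
  \<comment> \<open>Sharing two vertices with \<open>u\<close>, \<open>v\<close>, \<open>r\<close>
    while omitting \<open>u\<close> or \<open>v\<close> forces \<open>r\<close>. Taking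
    \<open>t\<close> and \<open>s\<close> for \<open>r\<close> would put two adjacent vertices into
    one independent triple.\<close>
  have meet: "r \<in> {x, y, z}"
    if xyz: "independent_triple x y z" and r: "independent_triple u v r"
      and miss: "u \<notin> {x, y, z} \<or> v \<notin> {x, y, z}" for x y z r
  proof -
    obtain p q t' s' where pq: "independent_triple p q t'"
        "{p, q, t'} = {x, y, z}" "{p, q, s'} = {u, v, r}"
      using share[OF xyz r] by blast
    then have "p \<noteq> q" "{p, q} \<subseteq> {x, y, z}" "{p, q} \<subseteq> {u, v, r}"
      by (auto simp: independent_triple_def)
    then show ?thesis using miss by auto
  qed
  have "u \<in> {x, y, z} \<and> v \<in> {x, y, z}" if xyz: "independent_triple x y z" for x y z
  proof (rule ccontr)
    assume "\<not> ?thesis"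
    then have "t \<in> {x, y, z}" "s \<in> {x, y, z}"
      using meet[OF xyz uvt(1)] meet[OF xyz uvt(2)] by blast+
    then show False
      using ts xyz adj_sym adj_irrefl unfolding independent_triple_def by blast
  qed
  then show False
    using swap_set_of_common_pair[OF uvt] no by blast
qed

end

theorem theorem33:
  fixes G :: "'a pair_pre_digraph"
  assumes "pair_graph G"
    and "Digraph_Component.connected (with_proj G)"
    and "\<exists>D. swap_set G D"
    and "independence_number G = 3"
  shows "DD_m G \<le> enat (independence_number G)"
proof -
  interpret pair_graph G by fact
  obtain D where D: "swap_set G D"
    using assms(3) by blast
  interpret independence_three_graph G
  proof
    fix a b c d
    assume *: "a \<in> pverts G" "b \<in> pverts G" "c \<in> pverts G" "d \<in> pverts G" "distinct [a, b, c, d]"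
      "(a, b) \<notin> parcs G" "(a, c) \<notin> parcs G" "(a, d) \<notin> parcs G"
      "(b, c) \<notin> parcs G" "(b, d) \<notin> parcs G" "(c, d) \<notin> parcs G"
    then have "independent_set G {a, b, c, d}"
      using adj_sym adj_irrefl unfolding independent_set_def by blast
    moreover have "card {a, b, c, d} = 4"
      using *(5) by simp
    ultimately show False
      using card_le_independence_number assms(4) by fastforce
  qed (use swap_set_neighbours[OF D] in blast)+
  have "\<exists>D. swap_set G D \<and> card D \<le> 3"
  \<comment> \<open>A small \<open>D\<close> already witnesses the bound; a larger one, with its
    disjoint partner set, supplies the six vertices needed.\<close>
  proof (cases "card D \<le> 3")
    case True
    then show ?thesis using D by blast
  next
    case False
    obtain S where S: "independent_set G S" "card S = 3"
      using independence_number_attained assms(4) by auto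
    obtain a b c where "S = {a, b, c}" "a \<noteq> b" "b \<noteq> c" "a \<noteq> c"
      using S(2) by (auto simp: card_3_iff)
    then have "independent_triple a b c"
      using S(1) by (simp add: independent_set_def independent_triple_def)
    moreover have "6 \<le> card (pverts G)"
      using swap_set_card_le[OF D] False by linarith
    ultimately show ?thesis
      using swap_set_of_independent_triple by (metis order_refl)
  qed
  then obtain D' where "swap_set G D'" "card D' \<le> 3" by blast
  then have "DD_m G \<le> enat (card D')"
    unfolding DD_m_def by (intro INF_lower) auto
  also have "\<dots> \<le> enat (independence_number G)"
    using \<open>card D' \<le> 3\<close> assms(4) by simp
  finally show ?thesis .
qed

end
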